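(* Let $X$ be a finite regular cellular decomposition of a (closed, connected) oriented surface of genus $g$, and let $(X,p)$ be a diagram realizing $X$ in $\mathbb{R}^2$. If the space of axial self stresses of $(X,p)$ has dimension greater than $4g$ (i.e. $\dim H_1\mathcal{F}>4g$), then there exists a non-trivial parallel realization $q$ of the dual cell complex $\tilde X$ in $\mathbb{R}^2$. The oriented length of each dual edge is equal to the force within its corresponding primal edge; that is, there is a self stress $w\in H_1\mathcal F$ with $$[e:f]\,(q_{\tilde f}-q_{\tilde h})=w_e\,\tau_e$$ for each edge $e$ of $X$ with incident faces $f,h$.
   Context: **Cells and dual.** A regular cell complex has cells that are topological disks whose boundaries consist of incident lower dimensional cells; $c\lhd d$ denotes that $c$ is a cell in the boundary of $d$. A signed incidence relation $[c:d]\in\{-1,0,1\}$ is fixed, nonzero iff $c\lhd d$ and $\dim d=\dim c+1$, with $[u:e][v:e]=-1$ for the two endpoints $u,v$ of an edge $e$, and $\sum_c[b:c][c:d]=0$ for all $b\lhd d$; it is induced by local orientations of cells, with all faces oriented consistently with the orientation of the surface (so $[e:f]=-[e:h]$ if $f,h$ are the two faces at $e$). The dual $\tilde X$ is the Poincaré dual cell decomposition of the surface: it has a vertex $\tilde f$ for each face $f$ of $X$, an edge $\tilde e$ for each edge $e$, joining $\tilde f$ and $\tilde h$ where $f,h$ are the faces incident to $e$, and a face $\tilde v$ for each vertex $v$. **Diagram.** A diagram $(X,p)$ in $\mathbb{R}^2$ is $X$ with an injective map $p$ from its vertex set to $\mathbb{R}^2$, $v\mapsto p_v$. Edges and faces may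 overlap in the plane. For an edge $e$ with endpoints $u,v$, $\tau_e$ denotes the unit vector in the direction of $[u:e]p_u+[v:e]p_v$. **Self stress.** $H_1\mathcal F$ is the first homology of the force cosheaf, i.e. the kernel of $\partial:\mathbb{R}^E\to(\mathbb{R}^2)^V$, $(\partial w)_v=\sum_{e:\,v\lhd e}[v:e]\,w_e\,\tau_e$, where $V,E$ are the vertex and edge sets of $X$. Its elements are the axial self stresses, and $w_e$ is the (signed) force in the edge $e$. **Parallel dual realization.** A parallel realization of $\tilde X$ in $\mathbb{R}^2$ is a map $q$ from the vertices of $\tilde X$ to $\mathbb{R}^2$ (not required to be injective) such that $q_{\tilde f}-q_{\tilde h}\in\operatorname{span}\{\tau_e\}$ for each edge $e$ of $X$ with incident faces $f,h$. It is non-trivial if $q$ is not constant (constant $q$ are the global translations). *)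

theory Defs
  imports "HOL-Analysis.Analysis"
begin

section \<open>Finite regular cell complexes\<close>

definition closed_disk :: "nat \<Rightarrow> (nat \<Rightarrow> real) topology" where
  "closed_disk n = subtopology (Euclidean_space n) {x. (\<Sum>i<n. (x i)\<^sup>2) \<le> 1}"

definition open_disk :: "nat \<Rightarrow> (nat \<Rightarrow> real) set" where
  "open_disk n = {x \<in> topspace (Euclidean_space n). (\<Sum>i<n. (x i)\<^sup>2) < 1}"

text \<open>
  The cells are labelled by a type, which is finite wherever finiteness is needed; a label stands
  for the open cell \<open>cell X c\<close>, a subset of the underlying space. The signed incidence
  number \<open>[c:d]\<close> is \<open>incidence X c d\<close>.
\<close>

record ('a, 'c) cell_complex =
  underlying :: "'a topology"
  cell :: "'c \<Rightarrow> 'a set"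
  cell_dim :: "'c \<Rightarrow> nat"
  incidence :: "'c \<Rightarrow> 'c \<Rightarrow> int"

definition cell_boundary :: "('a, 'c) cell_complex \<Rightarrow> 'c \<Rightarrow> 'a set" where
  "cell_boundary X c = (underlying X closure_of cell X c) - cell X c"

definition in_boundary :: "('a, 'c) cell_complex \<Rightarrow> 'c \<Rightarrow> 'c \<Rightarrow> bool" where
  "in_boundary X c d \<longleftrightarrow> cell X c \<subseteq> cell_boundary X d"

definition vertices :: "('a, 'c) cell_complex \<Rightarrow> 'c set" where
  "vertices X = {c. cell_dim X c = 0}"

definition edges :: "('a, 'c) cell_complex \<Rightarrow> 'c set" where
  "edges X = {c. cell_dim X c = 1}"

definition faces :: "('a, 'c) cell_complex \<Rightarrow> 'c set" where
  "faces X = {c. cell_dim X c = 2}"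

text \<open>
  Regularity is the requirement that the characteristic map of each cell is a homeomorphism of
  the closed disk onto the closure of the cell.
\<close>

definition regular_cell_complex :: "('a, 'c::finite) cell_complex \<Rightarrow> bool" where
  "regular_cell_complex X \<longleftrightarrow>
     Hausdorff_space (underlying X) \<and>
     (\<Union>c. cell X c) = topspace (underlying X) \<and>
     (\<forall>c d. c \<noteq> d \<longrightarrow> cell X c \<inter> cell X d = {}) \<and>
     (\<forall>c. \<exists>\<phi>. homeomorphic_map (closed_disk (cell_dim X c))
                 (subtopology (underlying X) (underlying X closure_of cell X c)) \<phi> \<and>
               \<phi> ` open_disk (cell_dim X c) = cell X c) \<and>
     (\<forall>d. cell_boundary X d =
            (\<Union>c \<in> {c. in_boundary X c d \<and> cell_dim X c < cell_dim X d}. cell X c))"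

definition signed_incidence :: "('a, 'c::finite) cell_complex \<Rightarrow> bool" where
  "signed_incidence X \<longleftrightarrow>
     (\<forall>c d. incidence X c d \<in> {-1, 0, 1}) \<and>
     (\<forall>c d. incidence X c d \<noteq> 0 \<longleftrightarrow> in_boundary X c d \<and> cell_dim X d = cell_dim X c + 1) \<and>
     (\<forall>e \<in> edges X. \<forall>u \<in> vertices X. \<forall>v \<in> vertices X.
        u \<noteq> v \<and> in_boundary X u e \<and> in_boundary X v e \<longrightarrow>
        incidence X u e * incidence X v e = -1) \<and>
     (\<forall>b d. in_boundary X b d \<longrightarrow> (\<Sum>c\<in>UNIV. incidence X b c * incidence X c d) = 0)"


section \<open>Cellular decompositions of oriented surfaces\<close>

text \<open>Second countability follows from compactness and the local condition.\<close>

definition closed_connected_surface :: "'a topology \<Rightarrow> bool" where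
  "closed_connected_surface S \<longleftrightarrow>
     Hausdorff_space S \<and> compact_space S \<and> connected_space S \<and>
     (\<forall>x \<in> topspace S. \<exists>U. openin S U \<and> x \<in> U \<and>
        subtopology S U homeomorphic_space Euclidean_space 2)"

text \<open>
  The dual edge of \<open>e\<close> joins the dual vertices of \<open>f\<close> and \<open>h\<close>,
  where \<open>f\<close> and \<open>h\<close> are the two faces incident to \<open>e\<close>.
\<close>

definition dual_edge_joins :: "('a, 'c) cell_complex \<Rightarrow> 'c \<Rightarrow> 'c \<Rightarrow> 'c \<Rightarrow> bool" where
  "dual_edge_joins X e f h \<longleftrightarrow>
     e \<in> edges X \<and> f \<in> faces X \<and> h \<in> faces X \<and> f \<noteq> h \<and>
     in_boundary X e f \<and> in_boundary X e h"

text \<open>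
  An orientation of the surface is a choice of local orientations of all faces that agree across
  every edge; in terms of incidence numbers, the two faces at an edge induce opposite
  orientations on it.
\<close>

definition oriented_surface_decomposition :: "('a, 'c::finite) cell_complex \<Rightarrow> bool" where
  "oriented_surface_decomposition X \<longleftrightarrow>
     closed_connected_surface (underlying X) \<and>
     regular_cell_complex X \<and> (\<forall>c. cell_dim X c \<le> 2) \<and>
     signed_incidence X \<and>
     (\<forall>e f h. dual_edge_joins X e f h \<longrightarrow> incidence X e f = - incidence X e h)"

definition euler_characteristic :: "('a, 'c::finite) cell_complex \<Rightarrow> int" where
  "euler_characteristic X = (\<Sum>c\<in>UNIV. (-1) ^ cell_dim X c)"

text \<open>The genus of a closed connected oriented surface is defined by \<open>\<chi> = 2 - 2g\<close>.\<close>

definition has_genus :: "('a, 'c::finite) cell_complex \<Rightarrow> nat \<Rightarrow> bool" where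
  "has_genus X g \<longleftrightarrow> euler_characteristic X = 2 - 2 * int g"


section \<open>Diagrams, self stresses and parallel dual realizations\<close>

definition diagram :: "('a, 'c) cell_complex \<Rightarrow> ('c \<Rightarrow> real ^ 2) \<Rightarrow> bool" where
  "diagram X p \<longleftrightarrow> inj_on p (vertices X)"

text \<open>The function \<^const>\<open>sgn\<close> normalizes a vector to unit length.\<close>

definition edge_direction ::
    "('a, 'c::finite) cell_complex \<Rightarrow> ('c \<Rightarrow> real ^ 2) \<Rightarrow> 'c \<Rightarrow> real ^ 2" where
  "edge_direction X p e =
     sgn (\<Sum>v \<in> {v \<in> vertices X. in_boundary X v e}. of_int (incidence X v e) *\<^sub>R p v)"

definition force_boundary ::
    "('a, 'c::finite) cell_complex \<Rightarrow> ('c \<Rightarrow> real ^ 2) \<Rightarrow> real ^ 'c \<Rightarrow> 'c \<Rightarrow> real ^ 2" where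
  "force_boundary X p w v =
     (\<Sum>e \<in> {e \<in> edges X. in_boundary X v e}.
        (of_int (incidence X v e) * w $ e) *\<^sub>R edge_direction X p e)"

text \<open>
  The space of functions on the edges is represented by the vectors indexed by all cells that
  vanish off the edges; the self stresses form a linear subspace of it.
\<close>

definition self_stresses ::
    "('a, 'c::finite) cell_complex \<Rightarrow> ('c \<Rightarrow> real ^ 2) \<Rightarrow> (real ^ 'c) set" where
  "self_stresses X p =
     {w. (\<forall>c. c \<notin> edges X \<longrightarrow> w $ c = 0) \<and> (\<forall>v \<in> vertices X. force_boundary X p w v = 0)}"

text \<open>
  The dual vertex of a face is labelled by that face, so that only the values of \<open>q\<close> on
  the faces matter.
\<close>

definition parallel_dual_realization ::
    "('a, 'c::finite) cell_complex \<Rightarrow> ('c \<Rightarrow> real ^ 2) \<Rightarrow> ('c \<Rightarrow> real ^ 2) \<Rightarrow> bool" where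
  "parallel_dual_realization X p q \<longleftrightarrow>
     (\<forall>e f h. dual_edge_joins X e f h \<longrightarrow> q f - q h \<in> span {edge_direction X p e})"

definition nontrivial_dual_realization ::
    "('a, 'c) cell_complex \<Rightarrow> ('c \<Rightarrow> real ^ 2) \<Rightarrow> bool" where
  "nontrivial_dual_realization X q \<longleftrightarrow> \<not> (\<exists>a. \<forall>f \<in> faces X. q f = a)"

end

theory Submission
  imports Defs
begin

text \<open>
  Let \<open>V\<close>, \<open>E\<close>, \<open>F\<close> be the numbers of vertices, edges and faces, and consider
  cellular chains with coefficients in the plane. A stress \<open>w\<close> gives the 1-chain
  \<open>e \<mapsto> w\<^sub>e \<tau>\<^sub>e\<close>, and equilibrium at all vertices says precisely that this chain is
  a cycle. A map \<open>q\<close> on the faces is a 2-chain, and its boundary at an edge with faces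
  \<open>f\<close> and \<open>h\<close> is \<open>[e:f] (q\<^sub>f - q\<^sub>h)\<close>. Thus a dual realization whose edges have the forces
  as oriented lengths is a pair \<open>(q, w)\<close> in which the boundary of \<open>q\<close> is the cycle of \<open>w\<close>,
  and the theorem asks for such a pair with \<open>q\<close> not constant.

  These pairs are the kernel of the linear map that sends \<open>(q, w)\<close> to the difference of the two
  cycles. Its source has dimension \<open>2F + s\<close>, where \<open>s > 4g\<close> is the dimension of the
  space of self stresses. Its values lie in the space of 1-cycles, of dimension at most
  \<open>2(E - V + 1)\<close> (lemma \<open>dim_edge_cycles_le\<close>). Hence the kernel has dimension at least
  \<open>2F + s - 2E + 2V - 2 = s + 2 - 4g > 2\<close>, by \<open>V - E + F = 2 - 2g\<close>. Since \<open>p\<close> is injective, no \<open>\<tau>\<^sub>e\<close>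
  vanishes, so \<open>q\<close> determines \<open>w\<close> in such a pair; if all these \<open>q\<close> were constant, the kernel
  would have dimension at most 2.

  The bound on cycles expresses that the 1-skeleton is connected: the orthogonal complement of
  the image of the boundary map consists of functions on the vertices that agree at the ends of
  every edge, and these are constant (lemma \<open>vertex_function_constant\<close>). The topology of the
  complex enters there, through the connectedness of the surface and of the boundary circles of
  the faces, and in the fact that an edge has two distinct ends. That an edge has at most two ends
  and at most two faces follows from the sign rules: three nonzero numbers cannot be pairwise
  opposite.
\<close>

section \<open>Boundaries of cells in a regular complex\<close>

text \<open>
  A homeomorphism of the closed disk onto the closed cell that carries the open disk onto the cell
  carries what remains, the sphere, onto the boundary of the cell.
\<close>

lemma characteristic_map:
  assumes "regular_cell_complex X"
  obtains \<phi> where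
    "continuous_map (closed_disk (cell_dim X c)) (underlying X) \<phi>"
    "inj_on \<phi> (topspace (closed_disk (cell_dim X c)))"
    "\<phi> ` open_disk (cell_dim X c) = cell X c"
    "\<phi> ` {x \<in> topspace (Euclidean_space (cell_dim X c)). (\<Sum>i<cell_dim X c. (x i)\<^sup>2) = 1}
       = cell_boundary X c"
proof -
  let ?n = "cell_dim X c"
  let ?S = "subtopology (underlying X) (underlying X closure_of cell X c)"
  obtain \<phi> where hom: "homeomorphic_map (closed_disk ?n) ?S \<phi>"
    and op: "\<phi> ` open_disk ?n = cell X c"
    using assms[unfolded regular_cell_complex_def, THEN conjunct2, THEN conjunct2, THEN conjunct2, THEN conjunct1, rule_format, of c] by blast
  have cont: "continuous_map (closed_disk ?n) (underlying X) \<phi>"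
    using continuous_map_into_fulltopology[OF homeomorphic_imp_continuous_map[OF hom]] .
  have inj: "inj_on \<phi> (topspace (closed_disk ?n))"
    using homeomorphic_imp_injective_map[OF hom] .
  have surj: "\<phi> ` topspace (closed_disk ?n) = underlying X closure_of cell X c"
    using homeomorphic_imp_surjective_map[OF hom]
    by (simp add: closure_of_subset_topspace inf_absorb2)
  have sub: "open_disk ?n \<subseteq> topspace (closed_disk ?n)"
    by (auto simp: open_disk_def closed_disk_def)
  have sphere: "topspace (closed_disk ?n) - open_disk ?n
      = {x \<in> topspace (Euclidean_space ?n). (\<Sum>i<?n. (x i)\<^sup>2) = 1}"
    by (auto simp: open_disk_def closed_disk_def)
  have "\<phi> ` (topspace (closed_disk ?n) - open_disk ?n)
      = \<phi> ` topspace (closed_disk ?n) - \<phi> ` open_disk ?n"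
    by (rule inj_on_image_set_diff[OF inj Diff_subset sub])
  then have "\<phi> ` {x \<in> topspace (Euclidean_space ?n). (\<Sum>i<?n. (x i)\<^sup>2) = 1}
      = cell_boundary X c"
    by (simp only: sphere surj op cell_boundary_def)
  then show thesis
    by (rule that[OF cont inj op])
qed

lemma cell_nonempty:
  assumes "regular_cell_complex X"
  shows "cell X c \<noteq> {}"
proof -
  obtain \<phi> where "\<phi> ` open_disk (cell_dim X c) = cell X c"
    using characteristic_map[OF assms] by metis
  moreover have "(\<lambda>i. 0) \<in> open_disk (cell_dim X c)"
    by (simp add: open_disk_def topspace_Euclidean_space)
  ultimately show ?thesis by blast
qed

lemma cell_disjoint:
  assumes "regular_cell_complex X" and "x \<in> cell X c" and "x \<in> cell X d"
  shows "c = d"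
  using assms(1)[unfolded regular_cell_complex_def, THEN conjunct2, THEN conjunct2, THEN conjunct1] assms(2,3) by blast

lemma cell_boundary_eq:
  assumes "regular_cell_complex X"
  shows "cell_boundary X d = (\<Union>c \<in> {c. in_boundary X c d \<and> cell_dim X c < cell_dim X d}. cell X c)"
  using assms[unfolded regular_cell_complex_def, THEN conjunct2, THEN conjunct2, THEN conjunct2, THEN conjunct2] by blast

lemma closure_cell_eq:
  assumes "regular_cell_complex X"
  shows "underlying X closure_of cell X d = cell X d \<union> cell_boundary X d"
proof -
  have "cell X d \<subseteq> topspace (underlying X)"
    using assms[unfolded regular_cell_complex_def, THEN conjunct2, THEN conjunct1] by blast
  then show ?thesis
    using closure_of_subset unfolding cell_boundary_def by blast
qed

text \<open>
  A cell in the boundary meets, and hence by disjointness is, one of the lower dimensional cells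
  that make up the boundary.
\<close>

lemma in_boundary_dim_less:
  assumes X: "regular_cell_complex X" and "in_boundary X c d"
  shows "cell_dim X c < cell_dim X d"
proof -
  obtain x where x: "x \<in> cell X c"
    using cell_nonempty[OF X] by blast
  then have "x \<in> cell_boundary X d"
    using assms(2) unfolding in_boundary_def by blast
  then show ?thesis
    unfolding cell_boundary_eq[OF X] using cell_disjoint[OF X x] by blast
qed

lemma in_boundary_trans:
  assumes X: "regular_cell_complex X" and bc: "in_boundary X b c" and cd: "in_boundary X c d"
  shows "in_boundary X b d"
proof -
  have "cell X b \<subseteq> underlying X closure_of cell X c"
    using bc unfolding in_boundary_def cell_boundary_def by blast
  also have "\<dots> \<subseteq> underlying X closure_of cell X d"
    by (rule closure_of_minimal)
      (use cd in \<open>auto simp: in_boundary_def cell_boundary_def\<close>)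
  finally have "cell X b \<subseteq> underlying X closure_of cell X d" .
  moreover have "b \<noteq> d"
    using in_boundary_dim_less[OF X bc] in_boundary_dim_less[OF X cd] by auto
  ultimately show ?thesis
    unfolding in_boundary_def cell_boundary_def using cell_disjoint[OF X] by blast
qed

lemma vertex_cell_singleton:
  assumes "regular_cell_complex X" and "v \<in> vertices X"
  shows "\<exists>a. cell X v = {a}"
proof -
  obtain \<phi> where "\<phi> ` open_disk (cell_dim X v) = cell X v"
    using characteristic_map[OF assms(1)] by metis
  moreover have "open_disk (cell_dim X v) = {\<lambda>i. 0}"
    using assms(2) by (auto simp: open_disk_def vertices_def topspace_Euclidean_space)
  ultimately show ?thesis
    by (metis image_empty image_insert)
qed

text \<open>
  The characteristic map sends the two ends of the interval to distinct points, and a vertex cell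
  is too small to contain both.
\<close>

lemma edge_has_two_vertices:
  assumes X: "regular_cell_complex X" and e: "e \<in> edges X"
  obtains u v where "u \<in> vertices X" "v \<in> vertices X" "u \<noteq> v"
    "in_boundary X u e" "in_boundary X v e"
proof -
  have dim: "cell_dim X e = 1"
    using e by (simp add: edges_def)
  obtain \<phi> where "continuous_map (closed_disk 1) (underlying X) \<phi>"
    and inj: "inj_on \<phi> (topspace (closed_disk 1))"
    and "\<phi> ` open_disk 1 = cell X e"
    and bd: "\<phi> ` {x \<in> topspace (Euclidean_space 1). (\<Sum>i<1. (x i)\<^sup>2) = 1} = cell_boundary X e"
    using characteristic_map[OF X, of e, unfolded dim] .
  define P where "P s = (\<lambda>i::nat. if i = 0 then s else (0::real))" for s
  have P: "P 1 \<in> topspace (closed_disk 1)" "P (-1) \<in> topspace (closed_disk 1)"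
    "P 1 \<in> {x \<in> topspace (Euclidean_space 1). (\<Sum>i<1. (x i)\<^sup>2) = (1::real)}"
    "P (-1) \<in> {x \<in> topspace (Euclidean_space 1). (\<Sum>i<1. (x i)\<^sup>2) = (1::real)}"
    by (simp_all add: P_def closed_disk_def topspace_Euclidean_space)
  have "P 1 0 \<noteq> P (-1) 0"
    by (simp add: P_def)
  then have "P 1 \<noteq> P (-1)"
    by metis
  then have ne: "\<phi> (P 1) \<noteq> \<phi> (P (-1))"
    using inj P by (meson inj_on_def)
  have vertex: "\<exists>u\<in>vertices X. in_boundary X u e \<and> x \<in> cell X u" if "x \<in> cell_boundary X e" for x
    using that unfolding cell_boundary_eq[OF X] by (auto simp: vertices_def dim)
  obtain u where u: "u \<in> vertices X" "in_boundary X u e" "\<phi> (P 1) \<in> cell X u"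
    using vertex bd P(3) by blast
  obtain v where v: "v \<in> vertices X" "in_boundary X v e" "\<phi> (P (-1)) \<in> cell X v"
    using vertex bd P(4) by blast
  have "u \<noteq> v"
    using vertex_cell_singleton[OF X u(1)] u(3) v(3) ne by auto
  then show thesis
    by (rule that[OF u(1) v(1) _ u(2) v(2)])
qed


section \<open>Connectedness of the 1-skeleton\<close>

lemma connectedin_circle:
  "connectedin (closed_disk 2) {x \<in> topspace (Euclidean_space 2). (\<Sum>i<2. (x i)\<^sup>2) = 1}"
    (is "connectedin _ ?C")
proof -
  define f where "f t = (\<lambda>i::nat. if i < 2 then (if i = 0 then cos t else sin t) else (0::real))" for t :: real
  have "continuous_map euclideanreal (Euclidean_space 2) f"
    unfolding f_def continuous_map_componentwise_Euclidean_space
    by (auto intro!: continuous_intros)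
  then have "continuous_map euclideanreal (closed_disk 2) f"
    unfolding closed_disk_def continuous_map_in_subtopology
    by (auto simp: f_def numeral_2_eq_2)
  then have "connectedin (closed_disk 2) (f ` UNIV)"
    by (rule connectedin_continuous_map_image) simp
  moreover have "f ` UNIV = ?C"
  proof
    show "f ` UNIV \<subseteq> ?C"
      by (auto simp: f_def numeral_2_eq_2 topspace_Euclidean_space)
    show "?C \<subseteq> f ` UNIV"
    proof
      fix x assume x: "x \<in> ?C"
      then have "(x 0)\<^sup>2 + (x 1)\<^sup>2 = 1"
        by (simp add: numeral_2_eq_2)
      then obtain t where "x 0 = cos t" "x 1 = sin t"
        using sincos_total_2pi by metis
      then have "x = f t"
        using x by (auto simp: f_def topspace_Euclidean_space fun_eq_iff less_2_cases_iff)
      then show "x \<in> f ` UNIV" by blast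
    qed
  qed
  ultimately show ?thesis by simp
qed

lemma connectedin_face_boundary:
  assumes X: "regular_cell_complex X" and d: "d \<in> faces X"
  shows "connectedin (underlying X) (cell_boundary X d)"
proof -
  have dim: "cell_dim X d = 2"
    using d by (simp add: faces_def)
  obtain \<phi> where cont: "continuous_map (closed_disk 2) (underlying X) \<phi>"
    and "inj_on \<phi> (topspace (closed_disk 2))"
    and "\<phi> ` open_disk 2 = cell X d"
    and bd: "\<phi> ` {x \<in> topspace (Euclidean_space 2). (\<Sum>i<2. (x i)\<^sup>2) = 1} = cell_boundary X d"
    using characteristic_map[OF X, of d, unfolded dim] .
  show ?thesis
    using connectedin_continuous_map_image[OF cont connectedin_circle] unfolding bd .
qed

lemma face_boundary_nonempty:
  assumes X: "regular_cell_complex X" and d: "d \<in> faces X"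
  shows "cell_boundary X d \<noteq> {}"
proof -
  have dim: "cell_dim X d = 2"
    using d by (simp add: faces_def)
  obtain \<phi> where cont: "continuous_map (closed_disk 2) (underlying X) \<phi>"
    and "inj_on \<phi> (topspace (closed_disk 2))"
    and "\<phi> ` open_disk 2 = cell X d"
    and bd: "\<phi> ` {x \<in> topspace (Euclidean_space 2). (\<Sum>i<2. (x i)\<^sup>2) = 1} = cell_boundary X d"
    using characteristic_map[OF X, of d, unfolded dim] .
  have "(\<lambda>i. if i = 0 then 1 else 0) \<in> {x \<in> topspace (Euclidean_space 2). (\<Sum>i<2. (x i)\<^sup>2) = 1}"
    by (simp add: topspace_Euclidean_space numeral_2_eq_2)
  then show ?thesis
    unfolding bd[symmetric] by blast
qed

text \<open>
  Such a union is also the union of the closures of finitely many cells.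
\<close>

lemma closedin_union_cells:
  assumes X: "regular_cell_complex X"
    and L: "\<And>c d. d \<in> L \<Longrightarrow> in_boundary X c d \<Longrightarrow> c \<in> L"
  shows "closedin (underlying X) (\<Union>c\<in>L. cell X c)"
proof -
  have "(\<Union>c\<in>L. cell X c) = (\<Union>c\<in>L. underlying X closure_of cell X c)"
    unfolding closure_cell_eq[OF X] cell_boundary_eq[OF X] using L by blast
  also have "closedin (underlying X) \<dots>"
    by (rule closedin_Union) auto
  finally show ?thesis .
qed

text \<open>
  The cells with the same label as \<open>a\<close> and the remaining cells of \<open>T\<close> would cover the
  connected union of \<open>T\<close> by two disjoint closed sets. This is used for the boundary of a face
  and for the whole surface.
\<close>

lemma incident_label_constant:
  assumes X: "regular_cell_complex X"
    and conn: "connectedin (underlying X) (\<Union>c\<in>T. cell X c)"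
    and T: "\<And>c d. d \<in> T \<Longrightarrow> in_boundary X c d \<Longrightarrow> c \<in> T"
    and l: "\<And>c d. d \<in> T \<Longrightarrow> in_boundary X c d \<Longrightarrow> l c = l d"
    and "a \<in> T" "b \<in> T"
  shows "l a = l b"
proof (rule ccontr)
  assume ne: "l a \<noteq> l b"
  define L M where "L = {c \<in> T. l c = l a}" and "M = {c \<in> T. l c \<noteq> l a}"
  have "closedin (underlying X) (\<Union>c\<in>L. cell X c)" "closedin (underlying X) (\<Union>c\<in>M. cell X c)"
    by (rule closedin_union_cells[OF X]; use T l in \<open>auto simp: L_def M_def\<close>)+
  moreover have "(\<Union>c\<in>T. cell X c) \<subseteq> (\<Union>c\<in>L. cell X c) \<union> (\<Union>c\<in>M. cell X c)"
    by (auto simp: L_def M_def)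
  moreover have "(\<Union>c\<in>L. cell X c) \<inter> (\<Union>c\<in>M. cell X c) \<inter> (\<Union>c\<in>T. cell X c) = {}"
    using cell_disjoint[OF X] unfolding L_def M_def by blast
  moreover have "cell X a \<subseteq> (\<Union>c\<in>L. cell X c) \<inter> (\<Union>c\<in>T. cell X c)"
    "cell X b \<subseteq> (\<Union>c\<in>M. cell X c) \<inter> (\<Union>c\<in>T. cell X c)"
    using assms(5,6) ne by (auto simp: L_def M_def)
  ultimately show False
    using conn cell_nonempty[OF X, of a] cell_nonempty[OF X, of b]
    unfolding connectedin_closedin by (metis subset_empty)
qed

text \<open>
  To propagate \<open>y\<close> through the surface, it is extended to a label of all cells: the label of a
  cell is the set of values of \<open>y\<close> at the vertices of its closure. Incident cells have nested
  labels, so it suffices that each label is a singleton. For an edge this is the hypothesis; for a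
  face it follows because the boundary of the face is a connected circle of vertices and edges.
\<close>

lemma vertex_function_constant:
  assumes X: "regular_cell_complex X"
    and conn: "connected_space (underlying X)"
    and dim2: "\<And>c. cell_dim X c \<le> 2"
    and edge: "\<And>e u v. e \<in> edges X \<Longrightarrow> u \<in> vertices X \<Longrightarrow> v \<in> vertices X \<Longrightarrow>
      in_boundary X u e \<Longrightarrow> in_boundary X v e \<Longrightarrow> y u = y v"
    and "a \<in> vertices X" "b \<in> vertices X"
  shows "y a = y b"
proof -
  define ends where "ends c = {v \<in> vertices X. v = c \<or> in_boundary X v c}" for c
  have ends_vertex: "ends v = {v}" if "v \<in> vertices X" for v
    using that in_boundary_dim_less[OF X, of _ v] by (auto simp: ends_def vertices_def)
  have ends_edge: "ends e = {v \<in> vertices X. in_boundary X v e}" if "e \<in> edges X" for e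
    using that by (auto simp: ends_def vertices_def edges_def)
  have ends_mono: "ends c \<subseteq> ends d" if "in_boundary X c d" for c d
    using that in_boundary_trans[OF X] by (auto simp: ends_def)
  have label: "\<exists>s. y ` ends c = {s}" if "cell_dim X c < 2" for c
  proof (cases "c \<in> vertices X")
    case True
    then show ?thesis by (simp add: ends_vertex)
  next
    case False
    then have e: "c \<in> edges X"
      using that by (auto simp: vertices_def edges_def)
    obtain u where u: "u \<in> ends c"
      using edge_has_two_vertices[OF X e] unfolding ends_edge[OF e] by blast
    have "y v = y u" if "v \<in> ends c" for v
      using that u edge[OF e] unfolding ends_edge[OF e] by blast
    then show ?thesis using u by blast
  qed
  have incident: "y ` ends c = y ` ends d"
    if i: "in_boundary X c d" "\<exists>s. y ` ends c = {s}" "\<exists>s. y ` ends d = {s}" for c d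
  proof -
    obtain s t where st: "y ` ends c = {s}" "y ` ends d = {t}"
      using i(2,3) by blast
    show ?thesis
      using image_mono[OF ends_mono[OF i(1)], of y] unfolding st by simp
  qed
  have label_face: "\<exists>s. y ` ends d = {s}" if d: "d \<in> faces X" for d
  proof -
    define T where "T = {c. in_boundary X c d}"
    have dimT: "cell_dim X c < 2" if "c \<in> T" for c
      using that d in_boundary_dim_less[OF X, of c d] by (simp add: T_def faces_def)
    have bd: "cell_boundary X d = (\<Union>c\<in>T. cell X c)"
      unfolding cell_boundary_eq[OF X] T_def using in_boundary_dim_less[OF X] by blast
    have same: "y ` ends c = y ` ends c'" if "c \<in> T" "c' \<in> T" for c c'
    proof (rule incident_label_constant[OF X _ _ _ that])
      show "connectedin (underlying X) (\<Union>c\<in>T. cell X c)"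
        using connectedin_face_boundary[OF X d] bd by simp
      show T: "c \<in> T" if "d \<in> T" "in_boundary X c d" for c d
        using that in_boundary_trans[OF X] by (auto simp: T_def)
      show "y ` ends c = y ` ends d" if "d \<in> T" "in_boundary X c d" for c d
        using incident label dimT T that by metis
    qed
    obtain c where c: "c \<in> T"
      using face_boundary_nonempty[OF X d] bd by blast
    obtain s where s: "y ` ends c = {s}"
      using label dimT c by blast
    have "d \<notin> vertices X"
      using d by (simp add: faces_def vertices_def)
    then have "ends d \<subseteq> T"
      by (auto simp: ends_def T_def)
    have "y v = s" if "v \<in> ends d" for v
    proof -
      have "v \<in> T" "v \<in> vertices X"
        using that \<open>ends d \<subseteq> T\<close> by (auto simp: ends_def)
      then show ?thesis
        using same[OF _ c, of v] s by (simp add: ends_vertex)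
    qed
    moreover have "ends d \<noteq> {}"
      using ends_mono[of c d] c s by (auto simp: T_def)
    ultimately show ?thesis by blast
  qed
  have label_all: "\<exists>s. y ` ends c = {s}" for c
    using label[of c] label_face[of c] dim2[of c] by (cases "cell_dim X c = 2") (auto simp: faces_def)
  have "y ` ends a = y ` ends b"
  proof (rule incident_label_constant[OF X])
    have "(\<Union>c\<in>UNIV. cell X c) = topspace (underlying X)"
      using X[unfolded regular_cell_complex_def, THEN conjunct2, THEN conjunct1] .
    then show "connectedin (underlying X) (\<Union>c\<in>UNIV. cell X c)"
      using conn by (simp add: connectedin_topspace)
  qed (use incident label_all in auto)
  then show ?thesis
    using assms(5,6) by (simp add: ends_vertex)
qed


section \<open>Signed incidence\<close>

lemma incidence_nonzero_iff:
  assumes "signed_incidence X"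
  shows "incidence X c d \<noteq> 0 \<longleftrightarrow> in_boundary X c d \<and> cell_dim X d = cell_dim X c + 1"
  using assms[unfolded signed_incidence_def, THEN conjunct2, THEN conjunct1, rule_format, of c d] .

text \<open>
  A third end \<open>w\<close> is excluded because the incidence numbers of \<open>u\<close>, \<open>v\<close> and
  \<open>w\<close> would have pairwise product \<open>-1\<close>.
\<close>

lemma edge_vertices_eq:
  assumes X: "regular_cell_complex X" and s: "signed_incidence X" and e: "e \<in> edges X"
  obtains u v where "u \<noteq> v" "{v \<in> vertices X. in_boundary X v e} = {u, v}"
    "incidence X v e = - incidence X u e" "incidence X u e \<in> {-1, 1}"
proof -
  obtain u v where uv: "u \<in> vertices X" "v \<in> vertices X" "u \<noteq> v"
    "in_boundary X u e" "in_boundary X v e"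
    using edge_has_two_vertices[OF X e] .
  have opposite: "incidence X b e = - incidence X a e" "incidence X a e \<in> {-1, 1}"
    if "a \<in> vertices X" "b \<in> vertices X" "a \<noteq> b" "in_boundary X a e" "in_boundary X b e" for a b
  proof -
    have p: "incidence X a e * incidence X b e = -1"
      using s[unfolded signed_incidence_def, THEN conjunct2, THEN conjunct2, THEN conjunct1] e that
      by blast
    have "incidence X a e \<in> {-1, 0, 1}"
      using s[unfolded signed_incidence_def, THEN conjunct1] by blast
    then show "incidence X b e = - incidence X a e" "incidence X a e \<in> {-1, 1}"
      using p by auto
  qed
  have "w = u \<or> w = v" if w: "w \<in> vertices X" "in_boundary X w e" for w
  proof (rule ccontr)
    assume "\<not> (w = u \<or> w = v)"
    then have "u \<noteq> w" "v \<noteq> w" by auto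
    have "incidence X v e = - incidence X u e" "incidence X w e = - incidence X u e"
      "incidence X w e = - incidence X v e"
      using opposite(1)[OF uv] opposite(1)[OF uv(1) w(1) \<open>u \<noteq> w\<close> uv(4) w(2)]
        opposite(1)[OF uv(2) w(1) \<open>v \<noteq> w\<close> uv(5) w(2)] by simp_all
    then have "incidence X u e = 0" by linarith
    then show False
      using opposite(2)[OF uv] by simp
  qed
  then have "{v \<in> vertices X. in_boundary X v e} = {u, v}"
    using uv by blast
  then show thesis
    by (rule that[OF uv(3) _ opposite[OF uv]])
qed

text \<open>
  A third face at the edge would make three nonzero incidence numbers pairwise opposite.
\<close>

lemma dual_edge_joins_incidence_support:
  assumes X: "oriented_surface_decomposition X" and j: "dual_edge_joins X e f h"
  shows "incidence X e c \<noteq> 0 \<longleftrightarrow> c = f \<or> c = h"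
proof -
  have "signed_incidence X"
    using X unfolding oriented_surface_decomposition_def by blast
  note s = incidence_nonzero_iff[OF this]
  have opp: "incidence X e a = - incidence X e b" if "dual_edge_joins X e a b" for a b
    using X that unfolding oriented_surface_decomposition_def by blast
  have nz: "incidence X e f \<noteq> 0" "incidence X e h \<noteq> 0"
    using j unfolding s by (auto simp: dual_edge_joins_def edges_def faces_def)
  have "c = f \<or> c = h" if c: "incidence X e c \<noteq> 0"
  proof (rule ccontr)
    assume "\<not> (c = f \<or> c = h)"
    then have "dual_edge_joins X e f c" "dual_edge_joins X e c h"
      using c j unfolding s by (auto simp: dual_edge_joins_def edges_def faces_def)
    then show False
      using opp[of f c] opp[of c h] opp[OF j] nz by linarith
  qed
  then show ?thesis using nz by blast
qed

text \<open>
  When \<open>b\<close> is not in the boundary of \<open>d\<close>, every summand vanishes, since incidence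
  is transitive.
\<close>

lemma incidence_product_zero:
  assumes X: "regular_cell_complex X" and s: "signed_incidence X"
  shows "(\<Sum>c\<in>UNIV. incidence X b c * incidence X c d) = 0"
proof (cases "in_boundary X b d")
  case True
  then show ?thesis
    using s[unfolded signed_incidence_def, THEN conjunct2, THEN conjunct2, THEN conjunct2] by blast
next
  case False
  have "incidence X b c = 0 \<or> incidence X c d = 0" for c
    using incidence_nonzero_iff[OF s, of b c] incidence_nonzero_iff[OF s, of c d]
      False in_boundary_trans[OF X, of b c d] by blast
  then show ?thesis
    by (intro sum.neutral) auto
qed


section \<open>Rank and nullity on a subspace\<close>

text \<open>
  The orthogonal complement of the kernel within \<open>S\<close> is mapped isomorphically onto the image.
\<close>

lemma dim_kernel_add_dim_image:
  fixes f :: "'m::euclidean_space \<Rightarrow> 'n::euclidean_space"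
  assumes f: "linear f" and S: "subspace S"
  shows "dim {x \<in> S. f x = 0} + dim (f ` S) = dim S"
proof -
  interpret linear f by (rule f)
  define K where "K = {x \<in> S. f x = 0}"
  define Q where "Q = {x \<in> S. \<forall>k\<in>K. orthogonal k x}"
  have K: "subspace K"
    using S by (auto simp: K_def subspace_def add scale zero)
  have Q: "subspace Q"
    using S by (auto simp: Q_def subspace_def orthogonal_clauses)
  have split: "dim Q + dim K = dim S"
    unfolding Q_def by (rule dim_subspace_orthogonal_to_vectors[OF K S]) (auto simp: K_def)
  have ker: "x = 0" if "x \<in> Q" "f x = 0" for x
    using that by (auto simp: Q_def K_def orthogonal_def)
  have "inj_on f Q"
  proof (rule inj_onI)
    fix x y assume xy: "x \<in> Q" "y \<in> Q" "f x = f y"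
    then show "x = y"
      using ker[OF subspace_diff[OF Q xy(1,2)]] by (simp add: diff)
  qed
  then have "inj_on f (span Q)"
    using Q by (metis span_eq_iff)
  then have "dim (f ` Q) = dim Q"
    by (rule dim_image_eq[OF f])
  moreover have "f ` Q = f ` S"
  proof
    show "f ` S \<subseteq> f ` Q"
    proof
      fix z assume "z \<in> f ` S"
      then obtain x where x: "x \<in> S" "z = f x" by blast
      obtain k r where k: "k \<in> span K" and r: "\<And>w. w \<in> span K \<Longrightarrow> orthogonal r w" and xkr: "x = k + r"
        using orthogonal_subspace_decomp_exists by metis
      have kK: "k \<in> K"
        using k K by (metis span_eq_iff)
      then have "k \<in> S" "f k = 0"
        by (auto simp: K_def)
      have "r = x - k"
        using xkr by simp
      then have "r \<in> S"
        using subspace_diff[OF S x(1) \<open>k \<in> S\<close>] by simp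
      moreover have "\<forall>k\<in>K. orthogonal k r"
        using r by (simp add: orthogonal_commute span_base)
      ultimately have "r \<in> Q"
        by (simp add: Q_def)
      moreover have "f r = z"
        using x(2) xkr \<open>f k = 0\<close> by (simp add: add)
      ultimately show "z \<in> f ` Q" by blast
    qed
  qed (auto simp: Q_def)
  ultimately show ?thesis
    using split by (simp add: K_def)
qed


section \<open>Chains with vector coefficients\<close>

text \<open>
  Chains are vectors indexed by all cells that vanish off the cells of the given dimension, so that
  chains of every degree, and the self stresses, lie in Euclidean spaces of fixed type.
\<close>

definition chains :: "('a, 'c::finite) cell_complex \<Rightarrow> nat \<Rightarrow> ('b::real_vector ^ 'c) set" where
  "chains X k = {r. \<forall>c. cell_dim X c \<noteq> k \<longrightarrow> r $ c = 0}"

definition chain_boundary ::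
    "('a, 'c::finite) cell_complex \<Rightarrow> 'b::real_vector ^ 'c \<Rightarrow> 'b ^ 'c" where
  "chain_boundary X r = (\<chi> b. \<Sum>c\<in>UNIV. of_int (incidence X b c) *\<^sub>R r $ c)"

lemma linear_chain_boundary: "linear (chain_boundary X)"
  by (rule linearI)
    (simp_all add: chain_boundary_def vec_eq_iff scaleR_add_right sum.distrib scaleR_sum_right mult.commute)

lemma subspace_chains: "subspace (chains X k)"
  by (auto simp: subspace_def chains_def)

lemma chain_boundary_in_chains:
  assumes "signed_incidence X" and "r \<in> chains X (Suc k)"
  shows "chain_boundary X r \<in> chains X k"
proof -
  have "of_int (incidence X b c) *\<^sub>R r $ c = 0" if "cell_dim X b \<noteq> k" for b c
  proof (cases "cell_dim X c = Suc k")
    case True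
    then have "incidence X b c = 0"
      using incidence_nonzero_iff[OF assms(1), of b c] that by auto
    then show ?thesis by simp
  next
    case False
    then show ?thesis using assms(2) by (simp add: chains_def)
  qed
  then show ?thesis
    by (auto simp: chains_def chain_boundary_def intro!: sum.neutral)
qed

lemma chain_boundary_boundary:
  assumes "regular_cell_complex X" and "signed_incidence X"
  shows "chain_boundary X (chain_boundary X r) = 0"
proof -
  have "(\<Sum>c\<in>UNIV. of_int (incidence X b c) *\<^sub>R (\<Sum>d\<in>UNIV. of_int (incidence X c d) *\<^sub>R r $ d)) = 0" for b
  proof -
    have "(\<Sum>c\<in>UNIV. of_int (incidence X b c) *\<^sub>R (\<Sum>d\<in>UNIV. of_int (incidence X c d) *\<^sub>R r $ d))
        = (\<Sum>d\<in>UNIV. \<Sum>c\<in>UNIV. of_int (incidence X b c * incidence X c d) *\<^sub>R r $ d)"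
      unfolding scaleR_sum_right by (subst sum.swap) simp
    also have "\<dots> = (\<Sum>d\<in>UNIV. of_int (\<Sum>c\<in>UNIV. incidence X b c * incidence X c d) *\<^sub>R r $ d)"
      by (simp only: of_int_sum scaleR_sum_left)
    also have "\<dots> = 0"
      by (simp add: incidence_product_zero[OF assms])
    finally show ?thesis .
  qed
  then show ?thesis
    by (simp add: chain_boundary_def vec_eq_iff)
qed

lemma dim_chains:
  "dim (chains X k :: ('b::euclidean_space ^ 'c::finite) set) = DIM('b) * card {c. cell_dim X c = k}"
proof -
  define D :: "('b ^ 'c) set" where "D = (\<lambda>(c, b). axis c b) ` ({c. cell_dim X c = k} \<times> Basis)"
  have inD: "axis c b \<in> D \<longleftrightarrow> cell_dim X c = k" if "b \<in> Basis" for c b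
    using that by (force simp: D_def axis_eq_axis)
  have "(chains X k :: ('b ^ 'c) set) = {x. \<forall>i\<in>Basis. i \<notin> D \<longrightarrow> x \<bullet> i = 0}"
    by (auto simp: chains_def Basis_vec_def inD inner_axis euclidean_eq_iff[where 'a='b])
  moreover have "D \<subseteq> Basis"
    by (auto simp: D_def Basis_vec_def)
  ultimately have "dim (chains X k :: ('b ^ 'c) set) = card D"
    by (simp add: dim_substandard)
  also have "inj_on (\<lambda>(c, b). axis c b) ({c. cell_dim X c = k} \<times> (Basis :: 'b set))"
    by (auto simp: inj_on_def axis_eq_axis)
  then have "card D = DIM('b) * card {c. cell_dim X c = k}"
    unfolding D_def by (simp add: card_image card_cartesian_product)
  finally show ?thesis .
qed

lemma dim_constant_chains:
  fixes X :: "('a, 'c::finite) cell_complex"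
  shows "dim {r \<in> chains X k. \<exists>a. \<forall>c. cell_dim X c = k \<longrightarrow> r $ c = (a::'b::euclidean_space)} \<le> DIM('b)"
proof -
  let ?i = "\<lambda>a::'b. \<chi> c::'c. if cell_dim X c = k then a else 0"
  have lin: "linear ?i"
    by (rule linearI) (auto simp: vec_eq_iff)
  have "{r \<in> chains X k. \<exists>a. \<forall>c. cell_dim X c = k \<longrightarrow> r $ c = (a::'b)} \<subseteq> range ?i"
  proof
    fix r :: "'b ^ 'c"
    assume "r \<in> {r \<in> chains X k. \<exists>a. \<forall>c. cell_dim X c = k \<longrightarrow> r $ c = a}"
    then obtain a where "r \<in> chains X k" "\<forall>c. cell_dim X c = k \<longrightarrow> r $ c = a"
      by blast
    then have "r = ?i a"
      by (simp add: chains_def vec_eq_iff)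
    then show "r \<in> range ?i" by (rule range_eqI)
  qed
  then have "dim {r \<in> chains X k. \<exists>a. \<forall>c. cell_dim X c = k \<longrightarrow> r $ c = (a::'b)} \<le> dim (range ?i)"
    by (rule dim_subset)
  also have "\<dots> \<le> DIM('b)"
    using dim_image_le[OF lin, of UNIV] by simp
  finally show ?thesis .
qed

text \<open>
  By rank and nullity, this is a lower bound for the rank of the boundary map from 1-chains to
  0-chains. A 0-chain \<open>y\<close> orthogonal to the image is constant on the vertices: pairing
  it with the boundary of the chain supported on an edge with ends \<open>u\<close> and \<open>v\<close>,
  with coefficient \<open>y\<^sub>u - y\<^sub>v\<close>, gives plus or minus the squared length of that coefficient.
\<close>

lemma dim_edge_cycles_le:
  fixes X :: "('a, 'c::finite) cell_complex"
  assumes X: "regular_cell_complex X" and s: "signed_incidence X"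
    and conn: "connected_space (underlying X)" and dim2: "\<And>c. cell_dim X c \<le> 2"
  shows "dim {r \<in> chains X 1. chain_boundary X r = (0 :: 'b::euclidean_space ^ 'c)}
      + DIM('b) * card (vertices X) \<le> DIM('b) * card (edges X) + DIM('b)"
proof -
  let ?C = "chains X :: nat \<Rightarrow> ('b ^ 'c) set"
  let ?d = "chain_boundary X :: 'b ^ 'c \<Rightarrow> 'b ^ 'c"
  let ?K = "{y \<in> ?C 0. \<forall>x \<in> ?d ` ?C 1. orthogonal x y}"
  have sub: "?d ` ?C 1 \<subseteq> ?C 0"
    using chain_boundary_in_chains[OF s, of _ 0] by auto
  have "subspace (?d ` ?C 1)"
    by (rule linear_subspace_image[OF linear_chain_boundary subspace_chains])
  then have K: "dim ?K + dim (?d ` ?C 1) = DIM('b) * card (vertices X)"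
    using dim_subspace_orthogonal_to_vectors[OF _ subspace_chains sub] by (simp add: dim_chains vertices_def)
  have nullity: "dim {r \<in> ?C 1. ?d r = 0} + dim (?d ` ?C 1) = DIM('b) * card (edges X)"
    using dim_kernel_add_dim_image[OF linear_chain_boundary subspace_chains]
    by (simp add: dim_chains edges_def)
  have const: "y $ a = y $ b" if y: "y \<in> ?K" and ab: "a \<in> vertices X" "b \<in> vertices X" for y a b
  proof (rule vertex_function_constant[OF X conn dim2 _ ab])
    fix e a b assume e: "e \<in> edges X" and ab: "a \<in> vertices X" "b \<in> vertices X"
      "in_boundary X a e" "in_boundary X b e"
    obtain u v where uv: "u \<noteq> v" "{v \<in> vertices X. in_boundary X v e} = {u, v}"
      "incidence X v e = - incidence X u e" "incidence X u e \<in> {-1, 1}"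
      using edge_vertices_eq[OF X s e] .
    define r :: "'b ^ 'c" where "r = axis e (y $ u - y $ v)"
    have "r \<in> ?C 1"
      using e by (auto simp: r_def chains_def axis_def edges_def)
    then have "orthogonal (?d r) y"
      using y by blast
    moreover have "?d r $ c = of_int (incidence X c e) *\<^sub>R (y $ u - y $ v)" for c
      by (simp add: chain_boundary_def r_def axis_def if_distrib[where f = "(*\<^sub>R) _"] cong: if_cong)
    ultimately have "(\<Sum>c\<in>UNIV. of_int (incidence X c e) * ((y $ u - y $ v) \<bullet> y $ c)) = 0"
      by (simp add: orthogonal_def inner_vec_def)
    moreover have "(\<Sum>c\<in>UNIV. of_int (incidence X c e) * ((y $ u - y $ v) \<bullet> y $ c))
        = (\<Sum>c\<in>{u, v}. of_int (incidence X c e) * ((y $ u - y $ v) \<bullet> y $ c))"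
    proof (rule sum.mono_neutral_right)
      have "incidence X c e = 0 \<or> y $ c = 0" if "c \<notin> {u, v}" for c
        using that y incidence_nonzero_iff[OF s, of c e]
        unfolding uv(2)[symmetric] chains_def vertices_def by auto
      then show "\<forall>c\<in>UNIV - {u, v}. of_int (incidence X c e) * ((y $ u - y $ v) \<bullet> y $ c) = 0"
        by fastforce
    qed auto
    ultimately have "of_int (incidence X u e) * ((y $ u - y $ v) \<bullet> (y $ u - y $ v)) = 0"
      using uv(1,3) by (simp add: inner_diff_right right_diff_distrib)
    then have "y $ u = y $ v"
      using uv(4) by auto
    moreover have "a \<in> {u, v}" "b \<in> {u, v}"
      using ab unfolding uv(2)[symmetric] by simp_all
    ultimately show "y $ a = y $ b"
      by (elim insertE emptyE) simp_all
  qed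
  have "?K \<subseteq> {r \<in> ?C 0. \<exists>a. \<forall>c. cell_dim X c = 0 \<longrightarrow> r $ c = a}"
  proof
    fix y assume y: "y \<in> ?K"
    have "\<exists>a. \<forall>c. cell_dim X c = 0 \<longrightarrow> y $ c = a"
    proof (cases "\<exists>v. v \<in> vertices X")
      case True
      then obtain v where "v \<in> vertices X" by blast
      then have "\<forall>c. cell_dim X c = 0 \<longrightarrow> y $ c = y $ v"
        using const[OF y] unfolding vertices_def by blast
      then show ?thesis by (rule exI)
    next
      case False
      then show ?thesis unfolding vertices_def by blast
    qed
    then show "y \<in> {r \<in> ?C 0. \<exists>a. \<forall>c. cell_dim X c = 0 \<longrightarrow> r $ c = a}"
      using y by blast
  qed
  from order_trans[OF dim_subset[OF this] dim_constant_chains]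
  show ?thesis
    using K nullity by linarith
qed


section \<open>Self stresses as cycles\<close>

lemma edge_direction_nonzero:
  assumes X: "regular_cell_complex X" and s: "signed_incidence X" and p: "diagram X p"
    and e: "e \<in> edges X"
  shows "edge_direction X p e \<noteq> 0"
proof -
  obtain u v where uv: "u \<noteq> v" "{v \<in> vertices X. in_boundary X v e} = {u, v}"
    "incidence X v e = - incidence X u e" "incidence X u e \<in> {-1, 1}"
    using edge_vertices_eq[OF X s e] .
  have "u \<in> vertices X" "v \<in> vertices X"
    using uv(2) by blast+
  then have "p u \<noteq> p v"
    using p uv(1) unfolding diagram_def inj_on_def by blast
  moreover have "edge_direction X p e = sgn (of_int (incidence X u e) *\<^sub>R (p u - p v))"
    unfolding edge_direction_def uv(2) using uv(1,3) by (simp add: scaleR_diff_right)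
  ultimately show ?thesis
    using uv(4) by (auto simp: sgn_zero_iff)
qed

definition force_chain ::
    "('a, 'c::finite) cell_complex \<Rightarrow> ('c \<Rightarrow> real ^ 2) \<Rightarrow> real ^ 'c \<Rightarrow> (real ^ 2) ^ 'c" where
  "force_chain X p w = (\<chi> e. w $ e *\<^sub>R edge_direction X p e)"

lemma linear_force_chain: "linear (force_chain X p)"
  by (rule linearI) (simp_all add: force_chain_def vec_eq_iff scaleR_add_left)

lemma force_chain_in_chains:
  assumes "w \<in> self_stresses X p"
  shows "force_chain X p w \<in> chains X 1"
  using assms by (auto simp: self_stresses_def chains_def force_chain_def edges_def)

text \<open>At a vertex, this boundary is the resultant of the forces in the edges there.\<close>

lemma chain_boundary_force_chain:
  assumes s: "signed_incidence X" and w: "w \<in> self_stresses X p"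
  shows "chain_boundary X (force_chain X p w) = 0"
proof -
  have "chain_boundary X (force_chain X p w) $ v = 0" for v
  proof (cases "v \<in> vertices X")
    case True
    have "chain_boundary X (force_chain X p w) $ v
        = (\<Sum>e\<in>UNIV. (of_int (incidence X v e) * w $ e) *\<^sub>R edge_direction X p e)"
      by (simp add: chain_boundary_def force_chain_def)
    also have "\<dots> = force_boundary X p w v"
      unfolding force_boundary_def
    proof (rule sum.mono_neutral_right)
      show "\<forall>e\<in>UNIV - {e \<in> edges X. in_boundary X v e}.
          (of_int (incidence X v e) * w $ e) *\<^sub>R edge_direction X p e = 0"
        using w incidence_nonzero_iff[OF s, of v] unfolding self_stresses_def by auto
    qed auto
    also have "\<dots> = 0"
      using w True unfolding self_stresses_def by blast
    finally show ?thesis .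
  next
    case False
    have "chain_boundary X (force_chain X p w) \<in> chains X 0"
      using chain_boundary_in_chains[OF s, of _ 0] force_chain_in_chains[OF w] by simp
    then show ?thesis
      using False by (simp add: chains_def vertices_def)
  qed
  then show ?thesis by (simp add: vec_eq_iff)
qed

lemma force_chain_eq_0_imp_eq_0:
  assumes "regular_cell_complex X" "signed_incidence X" "diagram X p"
    and w: "w \<in> self_stresses X p" "force_chain X p w = 0"
  shows "w = 0"
proof -
  have "w $ e = 0" for e
  proof (cases "e \<in> edges X")
    case True
    have "w $ e *\<^sub>R edge_direction X p e = force_chain X p w $ e"
      by (simp add: force_chain_def)
    then show ?thesis
      using w(2) edge_direction_nonzero[OF assms(1-3) True] by simp
  next
    case False
    then show ?thesis using w(1) unfolding self_stresses_def by blast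
  qed
  then show ?thesis by (simp add: vec_eq_iff)
qed

lemma subspace_self_stresses: "subspace (self_stresses X p)"
proof -
  have lin: "linear (\<lambda>w. force_boundary X p w v)" for v
    by (rule linearI)
      (simp_all add: force_boundary_def scaleR_sum_right sum.distrib[symmetric] algebra_simps)
  show ?thesis
    by (auto simp: self_stresses_def subspace_def linear_0[OF lin] linear_add[OF lin] linear_scale[OF lin])
qed

text \<open>
  Only \<open>f\<close> and \<open>h\<close> contribute, and by orientation their incidence numbers are opposite.
\<close>

lemma face_chain_boundary_at_edge:
  assumes X: "oriented_surface_decomposition X" and j: "dual_edge_joins X e f h"
  shows "chain_boundary X q $ e = of_int (incidence X e f) *\<^sub>R (q $ f - q $ h)"
proof -
  have "chain_boundary X q $ e = (\<Sum>c\<in>{f, h}. of_int (incidence X e c) *\<^sub>R q $ c)"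
    unfolding chain_boundary_def vec_lambda_beta
    by (rule sum.mono_neutral_right) (use dual_edge_joins_incidence_support[OF X j] in auto)
  moreover have "f \<noteq> h"
    using j unfolding dual_edge_joins_def by blast
  moreover have "incidence X e f = - incidence X e h"
    using X j unfolding oriented_surface_decomposition_def by blast
  ultimately show ?thesis
    by (simp add: scaleR_diff_right)
qed

lemma euler_characteristic_eq:
  assumes "\<And>c. cell_dim X c \<le> 2"
  shows "euler_characteristic X = int (card (vertices X)) - int (card (edges X)) + int (card (faces X))"
proof -
  have "(-1) ^ cell_dim X c = (of_bool (c \<in> vertices X) - of_bool (c \<in> edges X) + of_bool (c \<in> faces X) :: int)" for c
  proof -
    have "cell_dim X c \<in> {0, 1, 2}"
      using assms[of c] by auto
    then show ?thesis
      by (auto simp: vertices_def edges_def faces_def)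
  qed
  then show ?thesis
    unfolding euler_characteristic_def by (simp add: sum.distrib sum_subtractf)
qed


section \<open>Existence of a nontrivial dual realization\<close>

theorem mainTheorem2:
  fixes X :: "('a, 'c::finite) cell_complex"
    and p :: "'c \<Rightarrow> real ^ 2"
    and g :: nat
  assumes "oriented_surface_decomposition X"
    and "has_genus X g"
    and "diagram X p"
    and "dim (self_stresses X p) > 4 * g"
  shows "\<exists>q w. parallel_dual_realization X p q \<and> nontrivial_dual_realization X q \<and>
           w \<in> self_stresses X p \<and>
           (\<forall>e f h. dual_edge_joins X e f h \<longrightarrow>
              of_int (incidence X e f) *\<^sub>R (q f - q h) = (w $ e) *\<^sub>R edge_direction X p e)"
proof -
  note X = assms(1)
  have surf: "closed_connected_surface (underlying X)" and reg: "regular_cell_complex X"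
    and dim2: "\<And>c. cell_dim X c \<le> 2" and s: "signed_incidence X"
    using X unfolding oriented_surface_decomposition_def by blast+
  have conn: "connected_space (underlying X)"
    using surf unfolding closed_connected_surface_def by blast
  define C2 where "C2 = (chains X 2 :: ((real ^ 2) ^ 'c) set)"
  define S where "S = self_stresses X p"
  define Z where "Z = {r \<in> chains X 1. chain_boundary X r = (0 :: (real ^ 2) ^ 'c)}"
  define D where "D = (\<lambda>(q, w). chain_boundary X q - force_chain X p w)"
  define N where "N = {x \<in> C2 \<times> S. D x = 0}"
  have sub: "subspace C2" "subspace S"
    by (simp_all add: C2_def S_def subspace_chains subspace_self_stresses)
  have linD: "linear D"
    by (rule linearI)
      (auto simp: D_def linear_add[OF linear_chain_boundary] linear_add[OF linear_force_chain]
        linear_scale[OF linear_chain_boundary] linear_scale[OF linear_force_chain] scaleR_diff_right)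
  have Z: "subspace Z"
    unfolding Z_def using subspace_chains[of X 1]
    by (auto simp: subspace_def linear_0[OF linear_chain_boundary] linear_add[OF linear_chain_boundary]
        linear_scale[OF linear_chain_boundary])
  have "D x \<in> Z" if x: "x \<in> C2 \<times> S" for x
  proof -
    obtain q w where qw: "x = (q, w)" "q \<in> C2" "w \<in> S"
      using x by blast
    have "chain_boundary X q \<in> Z"
      using qw(2) chain_boundary_in_chains[OF s, of q 1] chain_boundary_boundary[OF reg s, of q]
      unfolding Z_def C2_def by (simp add: numeral_2_eq_2)
    moreover have "force_chain X p w \<in> Z"
      using qw(3) force_chain_in_chains chain_boundary_force_chain[OF s] unfolding Z_def S_def by blast
    ultimately show ?thesis
      unfolding qw(1) D_def by (simp add: subspace_diff[OF Z])
  qed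
  then have im: "dim (D ` (C2 \<times> S)) \<le> dim Z"
    by (intro dim_subset) blast
  have "dim N + dim (D ` (C2 \<times> S)) = dim C2 + dim S"
    unfolding N_def dim_Times[OF sub, symmetric]
    by (rule dim_kernel_add_dim_image[OF linD subspace_Times[OF sub]])
  moreover have "dim C2 = 2 * card (faces X)"
    by (simp add: C2_def dim_chains faces_def)
  moreover have "dim Z + 2 * card (vertices X) \<le> 2 * card (edges X) + 2"
    using dim_edge_cycles_le[OF reg s conn dim2, where 'b = "real ^ 2"] by (simp add: Z_def)
  moreover have "int (card (vertices X)) - int (card (edges X)) + int (card (faces X)) = 2 - 2 * int g"
    using assms(2) euler_characteristic_eq[OF dim2] unfolding has_genus_def by simp
  moreover have "dim S > 4 * g"
    using assms(4) by (simp add: S_def)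
  ultimately have big: "dim N > 2"
    using im by linarith
  \<comment> \<open>If every \<open>q\<close> were constant, projection to \<open>q\<close> would embed \<open>N\<close> into a plane.\<close>
  have "\<exists>(q, w) \<in> N. \<not> (\<exists>a. \<forall>f \<in> faces X. q $ f = a)"
  proof (rule ccontr)
    assume "\<not> ?thesis"
    then have "fst ` N \<subseteq> {q \<in> chains X 2. \<exists>a. \<forall>c. cell_dim X c = 2 \<longrightarrow> q $ c = a}"
      unfolding N_def C2_def faces_def by fastforce
    from order_trans[OF dim_subset[OF this] dim_constant_chains]
    have "dim (fst ` N) \<le> 2" by simp
    moreover have N: "subspace N"
      unfolding N_def using subspace_Times[OF sub]
      by (auto simp: subspace_def linear_0[OF linD] linear_add[OF linD] linear_scale[OF linD])
    have "x = 0" if x: "x \<in> N" "fst x = 0" for x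
    proof -
      have "force_chain X p (snd x) = 0" "snd x \<in> S"
        using x unfolding N_def D_def by (auto simp: linear_0[OF linear_chain_boundary])
      then show ?thesis
        using force_chain_eq_0_imp_eq_0[OF reg s assms(3)] x(2) unfolding S_def by (simp add: prod_eq_iff)
    qed
    then have "{x \<in> N. fst x = 0} \<subseteq> {0}"
      by blast
    then have "dim {x \<in> N. fst x = 0} = 0"
      by (simp only: dim_eq_0)
    then have "dim (fst ` N) = dim N"
      using dim_kernel_add_dim_image[OF linear_fst N] by linarith
    ultimately show False
      using big by simp
  qed
  then obtain q w where qw: "(q, w) \<in> N" and nonconst: "\<not> (\<exists>a. \<forall>f \<in> faces X. q $ f = a)"
    by blast
  have w: "w \<in> self_stresses X p" and eq: "chain_boundary X q = force_chain X p w"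
    using qw by (auto simp: N_def S_def D_def)
  have force: "of_int (incidence X e f) *\<^sub>R (q $ f - q $ h) = (w $ e) *\<^sub>R edge_direction X p e"
    if "dual_edge_joins X e f h" for e f h
    using face_chain_boundary_at_edge[OF X that, of q] unfolding eq force_chain_def by simp
  have parallel: "q $ f - q $ h \<in> span {edge_direction X p e}" if j: "dual_edge_joins X e f h" for e f h
  proof -
    have "incidence X e f \<noteq> 0"
      using dual_edge_joins_incidence_support[OF X j] by blast
    then have "q $ f - q $ h = (w $ e / of_int (incidence X e f)) *\<^sub>R edge_direction X p e"
      using force[OF j] by (simp add: vector_fraction_eq_iff eq_vector_fraction_iff)
    then show ?thesis
      by (simp add: span_base span_scale)
  qed
  show ?thesis
  proof (intro exI conjI)
    show "parallel_dual_realization X p (($) q)"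
      using parallel unfolding parallel_dual_realization_def by blast
    show "nontrivial_dual_realization X (($) q)"
      using nonconst unfolding nontrivial_dual_realization_def .
    show "w \<in> self_stresses X p" by (rule w)
  qed (use force in blast)
qed

end
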